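(* Let $G=(V,E)$ be a directed graph on $p\ge 2$ nodes, $V=\{0,1,\dots,p-1\}$, that has a self-loop at every node, is otherwise acyclic (i.e. becomes a directed acyclic graph when all self-loops are deleted), and has no isolated nodes. Consider the corresponding fourth-order discrete Lyapunov model with edge weight matrix $A$, whose self-loop weights $a_{ii}$ are non-zero for all $i\in V$. If $G$ is known (i.e. the zero pattern of $A$ is known), then $A$ is generically identifiable from the second-, third- and fourth-order cumulants $(S,T,R)$.
   Context: A directed graph $G=(V,E)$ has $E\subseteq V\times V$ (self-loops allowed); a node is isolated if no edge connects it to a different node. $\mathbb{R}^E$ is the set of real $p\times p$ matrices $A=(a_{ji})$ with $a_{ji}=0$ whenever $i\to j\notin E$; $\mathbb{R}^E_{\mathrm{stab}}\subseteq\mathbb{R}^E$ is the subset of Schur stable matrices (all complex eigenvalues have absolute value $<1$). For a diagonal symmetric tensor $\Omega^{(m)}$ of order $m$ on $\mathbb{R}^p$ (represented by its diagonal entries $\omega^{(m)}_0,\dots,\omega^{(m)}_{p-1}$) and $A\in\mathbb{R}^E_{\mathrm{stab}}$, let $T_m$ be the unique solution of the $m$th-order discrete Lyapunov equation $T_m=T_m\times_1A\times_2\cdots\times_mA+\Omega^{(m)}$, where $(T\times_kA)_{i_1\cdots i_{k-1}\,j\,i_{k+1}\cdots i_m}=\sum_{i_k}T_{i_1\cdots i_m}A_{j i_k}$. Write $S=T_2$, $T=T_3$, $R=T_4$. Parameter space: $\Theta$ is the set of tuples $\theta=(A,\Omega^{(2)},\Omega^{(3)},\Omega^{(4)})\in\mathbb{R}^E_{\mathrm{stab}}\times\mathbb{R}_{+}^p\times(\mathbb{R}\setminus\{0\})^p\times\mathbb{R}_{+}^p$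 with $a_{ii}\ne 0$ for all $i$, where $\mathbb{R}_+$ denotes the positive reals. Let $\varphi(\theta)=(S,T,R)$. "$A$ is generically identifiable" means: there is a proper algebraic subset $Z$ of $\Theta$ (the intersection of $\Theta$ with the zero set of polynomials in the free parameters, not all of $\Theta$) such that for all $\theta\in\Theta\setminus Z$ and all $\theta'\in\Theta$ with $\varphi(\theta')=\varphi(\theta)$, the matrix components of $\theta$ and $\theta'$ coincide, $A'=A$. *)

theory Defs
  imports "HOL-Analysis.Analysis"
begin

text \<open>
  The node set of the graph is the universe of a finite type \<open>'n\<close>, so that
  \<open>p = CARD('n)\<close>; a graph is its edge set \<open>E\<close>, with \<open>(i, j) \<in> E\<close> standing for the edge
  from \<open>i\<close> to \<open>j\<close>.
\<close>

definition isolated_node :: "('n \<times> 'n) set \<Rightarrow> 'n \<Rightarrow> bool" where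
  "isolated_node E v \<longleftrightarrow> (\<forall>u. u \<noteq> v \<longrightarrow> (u, v) \<notin> E \<and> (v, u) \<notin> E)"

definition matrix_eigenvalue :: "complex^'n^'n \<Rightarrow> complex \<Rightarrow> bool" where
  "matrix_eigenvalue M c \<longleftrightarrow> (\<exists>v. v \<noteq> 0 \<and> M *v v = c *s v)"

definition schur_stable :: "real^'n^'n \<Rightarrow> bool" where
  "schur_stable A \<longleftrightarrow> (\<forall>c. matrix_eigenvalue (map_matrix complex_of_real A) c \<longrightarrow> cmod c < 1)"

text \<open>The weight of the edge from \<open>i\<close> to \<open>j\<close> is the entry in row \<open>j\<close> and column \<open>i\<close>.\<close>

definition edge_matrices :: "('n \<times> 'n) set \<Rightarrow> (real^'n^'n) set" where
  "edge_matrices E = {A. \<forall>i j. (i, j) \<notin> E \<longrightarrow> A $ j $ i = 0}"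

definition stable_edge_matrices :: "('n \<times> 'n) set \<Rightarrow> (real^'n^'n) set" where
  "stable_edge_matrices E = {A \<in> edge_matrices E. schur_stable A}"

text \<open>
  A tensor of order \<open>m\<close> is a function on multi-indices, which are lists of length \<open>m\<close>.
  Fixing the value 0 on lists of any other length makes the representation unique.
  List positions, hence modes, are counted from 0.
\<close>

type_synonym 'n tensor = "'n list \<Rightarrow> real"

definition tensors :: "nat \<Rightarrow> 'n tensor set" where
  "tensors m = {T. \<forall>is. length is \<noteq> m \<longrightarrow> T is = 0}"

definition mode_product :: "nat \<Rightarrow> real^'n^'n \<Rightarrow> 'n tensor \<Rightarrow> ('n::finite) tensor" where
  "mode_product k A T = (\<lambda>is. if k < length is
     then (\<Sum>l\<in>UNIV. T (is[k := l]) * A $ (is ! k) $ l) else 0)"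

definition all_modes_product :: "nat \<Rightarrow> real^'n^'n \<Rightarrow> 'n tensor \<Rightarrow> ('n::finite) tensor" where
  "all_modes_product m A T = fold (\<lambda>k. mode_product k A) [0..<m] T"

definition diagonal_tensor :: "nat \<Rightarrow> real^'n \<Rightarrow> 'n tensor" where
  "diagonal_tensor m w = (\<lambda>is. if length is = m \<and> (\<exists>i. is = replicate m i)
     then w $ hd is else 0)"

definition lyapunov_solution :: "nat \<Rightarrow> real^'n^'n \<Rightarrow> real^'n \<Rightarrow> ('n::finite) tensor" where
  "lyapunov_solution m A w = (THE T. T \<in> tensors m \<and>
     (\<forall>is. T is = all_modes_product m A T is + diagonal_tensor m w is))"

text \<open>Diagonal tensors enter a parameter tuple through their vectors of diagonal entries.\<close>

type_synonym 'n params = "(real^'n^'n) \<times> (real^'n) \<times> (real^'n) \<times> (real^'n)"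

definition parameter_space :: "('n \<times> 'n) set \<Rightarrow> ('n::finite) params set" where
  "parameter_space E = {(A, w2, w3, w4).
     A \<in> stable_edge_matrices E \<and> (\<forall>i. A $ i $ i \<noteq> 0) \<and>
     (\<forall>i. w2 $ i > 0) \<and> (\<forall>i. w3 $ i \<noteq> 0) \<and> (\<forall>i. w4 $ i > 0)}"

definition cumulants :: "('n::finite) params \<Rightarrow> 'n tensor \<times> 'n tensor \<times> 'n tensor" where
  "cumulants = (\<lambda>(A, w2, w3, w4).
     (lyapunov_solution 2 A w2, lyapunov_solution 3 A w3, lyapunov_solution 4 A w4))"

text \<open>
  Polynomials are taken in all entries of \<open>(A, w2, w3, w4)\<close>. Entries of \<open>A\<close> outside the
  edge set vanish on the parameter space, so there these restrict to exactly the
  polynomials in the free parameters.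
\<close>

definition proper_algebraic_subset :: "('a::euclidean_space) set \<Rightarrow> 'a set \<Rightarrow> bool" where
  "proper_algebraic_subset \<Theta> Z \<longleftrightarrow>
     (\<exists>F. (\<forall>f\<in>F. real_polynomial_function f) \<and> Z = {\<theta> \<in> \<Theta>. \<forall>f\<in>F. f \<theta> = 0}) \<and> Z \<noteq> \<Theta>"

definition generically_identifiable :: "(('n::finite) \<times> 'n) set \<Rightarrow> bool" where
  "generically_identifiable E \<longleftrightarrow>
     (\<exists>Z. proper_algebraic_subset (parameter_space E) Z \<and>
       (\<forall>\<theta> \<in> parameter_space E - Z. \<forall>\<theta>' \<in> parameter_space E.
          cumulants \<theta>' = cumulants \<theta> \<longrightarrow> fst \<theta>' = fst \<theta>))"

end

theory Submission
  imports Defs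
begin

text \<open>
  The tensors satisfy, off the diagonal, Lyapunov equations that do not involve the noise, and by
  acyclicity all equations are triangular with respect to a grading of the nodes.

  Let \<open>i\<close> be a source with self-weight \<open>x\<close> and let \<open>j\<close> be its lowest child, with self-weight \<open>c\<close> and
  edge weight \<open>b\<close>. The quotients \<open>r\<^sub>n\<close> of the entries \<open>j i \<dots> i\<close> and \<open>i i \<dots> i\<close> (\<open>n\<close> trailing copies
  of \<open>i\<close>, \<open>n = 1, 2, 3\<close>) satisfy \<open>b / r\<^sub>n = x powi -n - c\<close>. Differences of these three equations give
  \<open>1 / x = (1 / r\<^sub>3 - 1 / r\<^sub>2) / (1 / r\<^sub>2 - 1 / r\<^sub>1)\<close> as soon as \<open>b \<noteq> 0\<close>.

  Let \<open>k\<close> have a parent \<open>i\<close> and suppose that the rows of all lower nodes are known. Cancelling the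
  invertible part of \<open>A\<close> that belongs to these nodes turns the equations of \<open>S\<close> and \<open>T\<close> into linear
  equations for row \<open>k\<close>. The equations for \<open>S\<close>, one for each lower node, together with one equation
  for \<open>T\<close> form a square system. Its determinant is a rational function of the parameters that is
  non-zero when \<open>i \<rightarrow> k\<close> is the only edge between different nodes, hence it is non-zero generically.
\<close>

section \<open>Multi-indices\<close>

abbreviation multi_indices :: "nat \<Rightarrow> 'n list set" where
  "multi_indices n \<equiv> {js. length js = n}"

lemma finite_multi_indices [simp]: "finite (multi_indices n :: 'n::finite list set)"
  using finite_lists_length_eq[of "UNIV :: 'n set" n] by simp

lemma sum_multi_indices_Suc:
  fixes f :: "'n::finite list \<Rightarrow> 'a::comm_monoid_add"
  shows "(\<Sum>js\<in>multi_indices (Suc n). f js) = (\<Sum>l\<in>UNIV. \<Sum>js\<in>multi_indices n. f (l # js))"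
  unfolding sum.cartesian_product
  by (rule sum.reindex_bij_witness[where i = "\<lambda>(l, js). l # js" and j = "\<lambda>js. (hd js, tl js)"])
     (auto simp: length_Suc_conv)

lemma sum_multi_indices_snoc:
  fixes f :: "'n::finite list \<Rightarrow> 'a::comm_monoid_add"
  shows "(\<Sum>js\<in>multi_indices (Suc n). f js) = (\<Sum>l\<in>UNIV. \<Sum>js\<in>multi_indices n. f (js @ [l]))"
  unfolding sum.cartesian_product
  by (rule sum.reindex_bij_witness[where i = "\<lambda>(l, js). js @ [l]" and j = "\<lambda>js. (last js, butlast js)"])
     (auto simp: length_Suc_conv_rev)

text \<open>An entry of a Kronecker power of \<open>A\<close>: applying \<open>A\<close> along all
  modes of a tensor is multiplication by this matrix on multi-indices.\<close>

definition kron :: "real^'n^'n \<Rightarrow> 'n list \<Rightarrow> 'n list \<Rightarrow> real" where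
  "kron A is js = prod_list (map2 (\<lambda>i j. A $ i $ j) is js)"

lemma kron_Nil [simp]: "kron A [] [] = 1"
  and kron_Cons [simp]: "kron A (i # is) (j # js) = A $ i $ j * kron A is js"
  by (simp_all add: kron_def)

lemma kron_append:
  "length is = length js \<Longrightarrow> kron A (is @ is') (js @ js') = kron A is js * kron A is' js'"
  by (simp add: kron_def)

text \<open>The induction needs the partial contraction over the first \<open>n\<close> modes. The
  mode treated last is the last entry of \<open>js\<close>, so the sum is extended at the end of the
  list.\<close>

lemma fold_mode_product:
  fixes T :: "'n::finite tensor"
  assumes "n \<le> length is"
  shows "fold (\<lambda>k. mode_product k A) [0..<n] T is =
    (\<Sum>js\<in>multi_indices n. kron A (take n is) js * T (js @ drop n is))"
  using assms
proof (induction n arbitrary: "is")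
  case 0
  then show ?case by simp
next
  case (Suc n)
  have tk: "take (Suc n) is = take n is @ [is ! n]"
    using Suc.prems by (simp add: take_Suc_conv_app_nth)
  have dr: "drop n (is[n := l]) = l # drop (Suc n) is" for l
    using Suc.prems by (simp add: drop_update_swap flip: Cons_nth_drop_Suc)
  have kr: "kron A (take (Suc n) is) (js @ [l]) = kron A (take n is) js * A $ (is ! n) $ l"
    if "length js = n" for js l
    using that Suc.prems unfolding tk by (subst kron_append) simp_all
  have "fold (\<lambda>k. mode_product k A) [0..<Suc n] T is =
      (\<Sum>l\<in>UNIV. fold (\<lambda>k. mode_product k A) [0..<n] T (is[n := l]) * A $ (is ! n) $ l)"
    using Suc.prems by (simp add: mode_product_def)
  also have "\<dots> = (\<Sum>l\<in>UNIV. \<Sum>js\<in>multi_indices n.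
      kron A (take n is) js * T (js @ l # drop (Suc n) is) * A $ (is ! n) $ l)"
    using Suc.prems by (simp add: Suc.IH dr sum_distrib_right)
  also have "\<dots> = (\<Sum>l\<in>UNIV. \<Sum>js\<in>multi_indices n.
      kron A (take (Suc n) is) (js @ [l]) * T ((js @ [l]) @ drop (Suc n) is))"
    by (intro sum.cong refl) (simp add: kr)
  finally show ?case
    by (simp only: sum_multi_indices_snoc)
qed

lemma all_modes_product_eq:
  fixes T :: "'n::finite tensor"
  assumes "length is = m"
  shows "all_modes_product m A T is = (\<Sum>js\<in>multi_indices m. kron A is js * T js)"
  using assms by (simp add: all_modes_product_def fold_mode_product)

text \<open>On a list that is too short the last mode product takes its default value 0; on one that
  is too long only entries of \<open>T\<close> at lists of the wrong length enter.\<close>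

lemma all_modes_product_tensors:
  fixes T :: "'n::finite tensor"
  assumes "T \<in> tensors m" and "length is \<noteq> m"
  shows "all_modes_product m A T is = 0"
proof (cases "length is < m")
  case True
  then obtain m' where "m = Suc m'" by (cases m) auto
  with True show ?thesis by (simp add: all_modes_product_def mode_product_def)
next
  case False
  with assms show ?thesis
    by (auto simp: all_modes_product_def fold_mode_product tensors_def intro!: sum.neutral)
qed

section \<open>Lyapunov equations on acyclic graphs\<close>

text \<open>Turns acyclicity into a numerical measure, so that nodes, and multi-indices through the
  sum of their grades, can be treated by induction.\<close>

locale graded_graph =
  fixes E :: "('n::finite \<times> 'n) set" and h :: "'n \<Rightarrow> nat"
  assumes h_less: "(u, v) \<in> E \<Longrightarrow> u \<noteq> v \<Longrightarrow> h u < h v"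

lemma acyclic_imp_graded_graph:
  fixes E :: "('n::finite \<times> 'n) set"
  assumes "acyclic (E - Id)"
  obtains h where "graded_graph E h"
proof -
  \<comment> \<open>The number of proper ancestors. Along an edge \<open>u \<rightarrow> v\<close>
    the ancestors of \<open>u\<close> are inherited and \<open>u\<close> itself is gained, since it
    lies on no cycle.\<close>
  define h where "h v = card {u. (u, v) \<in> (E - Id)\<^sup>+}" for v
  have "h u < h v" if "(u, v) \<in> E" "u \<noteq> v" for u v
  proof -
    have "(u, v) \<in> (E - Id)\<^sup>+" using that by auto
    moreover have "(u, u) \<notin> (E - Id)\<^sup>+" using assms by (auto simp: acyclic_def)
    ultimately show ?thesis
      unfolding h_def by (intro psubset_card_mono) (auto intro: trancl_trans)
  qed
  then show ?thesis using that[of h] by (simp add: graded_graph_def)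
qed

section \<open>Solution of the Lyapunov equation by recursion on height\<close>

context
  fixes h :: "'n::finite \<Rightarrow> nat" and A :: "real^'n^'n" and b :: "'n tensor"
begin

text \<open>Forward substitution: besides \<open>is\<close> itself only multi-indices of smaller
  height contribute, and the term of \<open>is\<close> is moved to the left and divided off. The
  order of the tensor is the length of the argument.\<close>

function triangular_solution :: "'n tensor" where
  "triangular_solution is =
    (b is + (\<Sum>js\<in>multi_indices (length is).
      if sum_list (map h js) < sum_list (map h is) then kron A is js * triangular_solution js else 0))
    / (1 - kron A is is)"
  by auto
termination
  by (relation "Wellfounded.measure (\<lambda>is. sum_list (map h is))") auto

end

declare triangular_solution.simps [simp del]

lemma kron_diag: "kron A is is = (\<Prod>i\<leftarrow>is. A $ i $ i)"
  by (induction "is") simp_all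

lemma kron_replicate: "kron A (replicate n i) (replicate n j) = (A $ i $ j) ^ n"
  by (induction n) simp_all

lemma kron_diag_nonzero:
  "(\<And>i. i \<in> set is \<Longrightarrow> A $ i $ i \<noteq> 0) \<Longrightarrow> kron A is is \<noteq> 0"
  by (induction "is") auto

lemma abs_kron_diag_less_one:
  assumes "\<And>i. \<bar>A $ i $ i\<bar> < 1" and "is \<noteq> []"
  shows "\<bar>kron A is is\<bar> < 1"
  using assms(2)
proof (induction "is" rule: list_nonempty_induct)
  case (single i)
  then show ?case using assms(1) by simp
next
  case (cons i "is")
  then show ?case using assms(1)[of i] mult_strict_mono[of "\<bar>A $ i $ i\<bar>" 1 "\<bar>kron A is is\<bar>" 1]
    by (simp add: abs_mult)
qed

context graded_graph
begin

abbreviation height :: "'n list \<Rightarrow> nat" where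
  "height is \<equiv> sum_list (map h is)"

text \<open>A non-zero product uses an edge or a loop at every position, so no grade increases from
  \<open>is\<close> to \<open>js\<close>, and equal sums leave only loops.\<close>

lemma kron_nonzero_height:
  assumes "A \<in> edge_matrices E" and "length is = length js" and "kron A is js \<noteq> 0"
  shows "height js \<le> height is \<and> (height js = height is \<longrightarrow> js = is)"
  using assms(2,3)
proof (induction "is" js rule: list_induct2)
  case Nil
  then show ?case by simp
next
  case (Cons i "is" j js)
  then have "(j, i) \<in> E" using assms(1) by (auto simp: edge_matrices_def)
  then have "j = i \<or> h j < h i" using h_less by blast
  then show ?case using Cons by auto
qed

lemma kron_eq_0:
  assumes "A \<in> edge_matrices E" and "length is = length js"
    and "js \<noteq> is" and "\<not> height js < height is"
  shows "kron A is js = 0"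
  using kron_nonzero_height[OF assms(1,2)] assms(3,4) by fastforce

text \<open>The Kronecker power is triangular with respect to height.\<close>

lemma sum_kron_split:
  assumes "A \<in> edge_matrices E"
  shows "(\<Sum>js\<in>multi_indices (length is). kron A is js * T js) = kron A is is * T is +
    (\<Sum>js\<in>multi_indices (length is). if height js < height is then kron A is js * T js else 0)"
proof -
  have "(\<Sum>js\<in>multi_indices (length is). kron A is js * T js) =
      (\<Sum>js\<in>multi_indices (length is). (if js = is then kron A is is * T is else 0) +
        (if height js < height is then kron A is js * T js else 0))"
    by (intro sum.cong refl) (use kron_eq_0[OF assms] in auto)
  then show ?thesis by (simp add: sum.distrib)
qed

text \<open>Gives meaning to the \<open>THE\<close> in \<open>lyapunov_solution\<close>. The
  coefficients \<open>1 - kron A is is\<close> are non-zero, as \<open>m > 0\<close> excludes the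
  empty multi-index with its empty product 1. Existence is forward substitution, uniqueness is
  induction on height.\<close>

lemma lyapunov_solution_unique:
  assumes A: "A \<in> edge_matrices E" "\<And>i. \<bar>A $ i $ i\<bar> < 1" and m: "m > 0"
  shows "\<exists>!T. T \<in> tensors m \<and> (\<forall>is. T is = all_modes_product m A T is + diagonal_tensor m w is)"
proof -
  have nz: "1 - kron A is is \<noteq> 0" if "length is = m" for "is"
    using abs_kron_diag_less_one[of A "is"] A(2) that m by fastforce
  have eq_iff: "T is = all_modes_product m A T is + diagonal_tensor m w is \<longleftrightarrow>
     T is = (diagonal_tensor m w is + (\<Sum>js\<in>multi_indices (length is).
       if height js < height is then kron A is js * T js else 0)) / (1 - kron A is is)"
    if "length is = m" for T "is"
    using that nz[OF that] sum_kron_split[OF A(1), of "is" T]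
    by (simp add: all_modes_product_eq field_simps)
  show ?thesis
  proof (rule ex_ex1I)
    define T where "T is = (if length is = m
      then triangular_solution h A (diagonal_tensor m w) is else 0)" for "is"
    have T: "T \<in> tensors m" by (auto simp: T_def tensors_def)
    have "T is = all_modes_product m A T is + diagonal_tensor m w is" for "is"
    proof (cases "length is = m")
      case True
      have sum_eq: "(\<Sum>js\<in>multi_indices (length is). if height js < height is
          then kron A is js * triangular_solution h A (diagonal_tensor m w) js else 0) =
        (\<Sum>js\<in>multi_indices (length is).
          if height js < height is then kron A is js * T js else 0)"
        by (intro sum.cong refl) (simp add: T_def True)
      have "triangular_solution h A (diagonal_tensor m w) is =
        (diagonal_tensor m w is + (\<Sum>js\<in>multi_indices (length is).
       if height js < height is then kron A is js * T js else 0)) / (1 - kron A is is)"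
        by (subst triangular_solution.simps) (simp only: sum_eq)
      with True show ?thesis by (subst eq_iff) (auto simp: T_def)
    next
      case False
      then show ?thesis
        using all_modes_product_tensors[OF T False] by (auto simp: T_def diagonal_tensor_def)
    qed
    with T show "\<exists>T. T \<in> tensors m \<and>
      (\<forall>is. T is = all_modes_product m A T is + diagonal_tensor m w is)" by blast
  next
    fix T T' :: "'n tensor"
    assume T: "T \<in> tensors m \<and>
        (\<forall>is. T is = all_modes_product m A T is + diagonal_tensor m w is)"
      and T': "T' \<in> tensors m \<and>
        (\<forall>is. T' is = all_modes_product m A T' is + diagonal_tensor m w is)"
    have "T is = T' is" for "is"
    proof (induction "is" rule: measure_induct_rule[of height])
      case (less "is")
      show ?case
      proof (cases "length is = m")
        case True
        have "(\<Sum>js\<in>multi_indices (length is).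
            if height js < height is then kron A is js * T js else 0) =
          (\<Sum>js\<in>multi_indices (length is).
            if height js < height is then kron A is js * T' js else 0)"
          by (intro sum.cong refl) (simp add: less)
        with eq_iff[OF True, of T] eq_iff[OF True, of T'] T T' show ?thesis by metis
      next
        case False
        moreover have "T \<in> tensors m" "T' \<in> tensors m" using T T' by blast+
        ultimately show ?thesis by (simp add: tensors_def)
      qed
    qed
    then show "T = T'" by blast
  qed
qed

lemma lyapunov_solution_eq:
  assumes A: "A \<in> edge_matrices E" "\<And>i. \<bar>A $ i $ i\<bar> < 1" and "m > 0" and "length is = m"
  shows "lyapunov_solution m A w is =
    (\<Sum>js\<in>multi_indices m. kron A is js * lyapunov_solution m A w js) + diagonal_tensor m w is"
  using theI'[OF lyapunov_solution_unique[OF assms(1-3), of w]] all_modes_product_eq[OF assms(4)]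
  unfolding lyapunov_solution_def[symmetric] by metis


lemma lyapunov_solution_rec:
  assumes "A \<in> edge_matrices E" "\<And>i. \<bar>A $ i $ i\<bar> < 1" and "is \<noteq> []"
  shows "lyapunov_solution (length is) A w is =
    (diagonal_tensor (length is) w is + (\<Sum>js\<in>multi_indices (length is).
      if height js < height is then kron A is js * lyapunov_solution (length is) A w js else 0))
    / (1 - kron A is is)"
proof -
  have "1 - kron A is is \<noteq> 0"
    using abs_kron_diag_less_one[of A "is"] assms(2,3) by fastforce
  then show ?thesis
    using lyapunov_solution_eq[OF assms(1,2), of "length is" "is" w] assms(3)
      sum_kron_split[OF assms(1), of "is" "lyapunov_solution (length is) A w"]
    by (simp add: field_simps)
qed

section \<open>Schur stability on acyclic graphs\<close>

text \<open>Ordered by height, \<open>A\<close> is triangular, so its eigenvalues are its diagonal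
  entries.\<close>

lemma schur_stable_iff:
  assumes A: "A \<in> edge_matrices E"
  shows "schur_stable A \<longleftrightarrow> (\<forall>i. \<bar>A $ i $ i\<bar> < 1)"
proof
  assume stable: "schur_stable A"
  show "\<forall>i. \<bar>A $ i $ i\<bar> < 1"
  proof
    fix i
    define c where "c = A $ i $ i"
    define L where "L v = A *v v - c *\<^sub>R v" for v
    have L_nth: "L v $ j = (\<Sum>l\<in>UNIV. A $ j $ l * v $ l) - c * v $ j" for v j
      by (simp add: L_def matrix_vector_mult_def)
    have lin: "linear L"
      by (rule linearI) (simp_all add: L_def algebra_simps matrix_vector_mult_add_rdistrib
          vec.add vec.scale scalar_mult_eq_scaleR[symmetric] matrix_vector_mult_scaleR)
    \<comment> \<open>The vectors supported strictly above \<open>i\<close>. By triangularity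
      \<open>L\<close> maps both \<open>W\<close> and \<open>axis i 1\<close> into \<open>W\<close>.
      If \<open>L\<close> were injective, it would map \<open>W\<close> onto itself by dimension,
      and \<open>axis i 1\<close> would have to lie in \<open>W\<close>.\<close>
    define W :: "(real^'n) set" where "W = {v. \<forall>j. h j \<le> h i \<longrightarrow> v $ j = 0}"
    have W: "subspace W" by (auto simp: W_def subspace_def)
    have A0: "A $ j $ l = 0" if "h j \<le> h l" "j \<noteq> l" for j l
      using that A h_less[of l j] by (force simp: edge_matrices_def)
    have "\<exists>v. v \<noteq> 0 \<and> L v = 0"
    proof (rule ccontr)
      assume "\<not> ?thesis"
      then have inj: "inj L" using lin by (auto simp: linear_injective_0)
      have sub: "L ` W \<subseteq> W"
      proof
        fix x assume "x \<in> L ` W"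
        then obtain v where v: "v \<in> W" "x = L v" by blast
        have "L v $ j = 0" if "h j \<le> h i" for j
        proof -
          have "A $ j $ l * v $ l = 0" for l
            using v(1) that A0[of j l] unfolding W_def
            by (cases "h l \<le> h i") (force simp: not_le)+
          then have "(\<Sum>l\<in>UNIV. A $ j $ l * v $ l) = 0" by (intro sum.neutral) blast
          then show ?thesis using v(1) that by (simp add: L_nth W_def)
        qed
        then show "x \<in> W" using v by (simp add: W_def)
      qed
      have "dim (L ` W) = dim W"
        using lin inj by (intro dim_image_eq) (auto intro: inj_on_subset)
      then have "L ` W = W"
        using sub W lin by (intro subspace_dim_equal linear_subspace_image) auto
      moreover have "L (axis i 1) \<in> W"
        by (auto simp: W_def L_nth axis_def c_def A0 if_distrib[of "\<lambda>x. _ * x"] cong: if_cong)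
      ultimately have "axis i 1 \<in> W" using inj by (metis inj_image_mem_iff)
      then show False by (auto simp: W_def axis_def)
    qed
    then obtain v where v: "v \<noteq> 0" "L v = 0" by blast
    define u :: "complex^'n" where "u = (\<chi> j. complex_of_real (v $ j))"
    have "u \<noteq> 0" using v(1) by (auto simp: u_def vec_eq_iff)
    moreover have "map_matrix complex_of_real A *v u = complex_of_real c *s u"
    proof -
      have "(\<Sum>l\<in>UNIV. A $ j $ l * v $ l) = c * v $ j" for j
        using L_nth[of v j] v(2) by simp
      then have "(\<Sum>l\<in>UNIV. complex_of_real (A $ j $ l) * complex_of_real (v $ l)) =
          complex_of_real c * complex_of_real (v $ j)" for j
        by (simp flip: of_real_mult of_real_sum)
      then show ?thesis
        by (simp add: vec_eq_iff matrix_vector_mult_def u_def map_matrix_def)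
    qed
    ultimately show "\<bar>A $ i $ i\<bar> < 1"
      using stable unfolding schur_stable_def matrix_eigenvalue_def c_def
      by (metis norm_of_real real_norm_def)
  qed
next
  assume diag: "\<forall>i. \<bar>A $ i $ i\<bar> < 1"
  show "schur_stable A"
    unfolding schur_stable_def matrix_eigenvalue_def
  proof (intro allI impI, elim exE conjE)
    fix c and v :: "complex^'n"
    assume v: "v \<noteq> 0" and eig: "map_matrix complex_of_real A *v v = c *s v"
    \<comment> \<open>At a lowest node of the support of an eigenvector only the diagonal term of
      the row survives.\<close>
    obtain i where i: "v $ i \<noteq> 0" and min: "\<And>j. v $ j \<noteq> 0 \<Longrightarrow> h i \<le> h j"
      using ex_has_least_nat[of "\<lambda>i. v $ i \<noteq> 0" _ h] v by (auto simp: vec_eq_iff)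
    have "c * v $ i = (\<Sum>j\<in>UNIV. of_real (A $ i $ j) * v $ j)"
      using arg_cong[OF eig, of "\<lambda>x. x $ i"]
      by (simp add: matrix_vector_mult_def map_matrix_def)
    also have "\<dots> = (\<Sum>j\<in>UNIV. if j = i then of_real (A $ i $ i) * v $ i else 0)"
      using A h_less[of _ i] min by (intro sum.cong) (force simp: edge_matrices_def)+
    finally have "c = of_real (A $ i $ i)" using i by simp
    with diag show "cmod c < 1" by simp
  qed
qed

lemma mem_parameter_space_iff:
  "(A, w2, w3, w4) \<in> parameter_space E \<longleftrightarrow>
    A \<in> edge_matrices E \<and> (\<forall>i. \<bar>A $ i $ i\<bar> < 1 \<and> A $ i $ i \<noteq> 0) \<and>
    (\<forall>i. w2 $ i > 0) \<and> (\<forall>i. w3 $ i \<noteq> 0) \<and> (\<forall>i. w4 $ i > 0)"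
  using schur_stable_iff[of A] by (auto simp: parameter_space_def stable_edge_matrices_def)

section \<open>Source nodes\<close>

text \<open>Row \<open>i\<close> of \<open>A\<close> has only its loop entry, so each of the
  \<open>n\<close> modes contributes a factor \<open>A $ i $ i\<close>.\<close>

lemma sum_kron_source:
  assumes A: "A \<in> edge_matrices E" and src: "\<And>l. (l, i) \<in> E \<Longrightarrow> l = i"
  shows "(\<Sum>js\<in>multi_indices n. kron A (replicate n i) js * f js) =
    (A $ i $ i) ^ n * f (replicate n i)"
proof (induction n arbitrary: f)
  case 0
  then show ?case by simp
next
  case (Suc n)
  have "(\<Sum>js\<in>multi_indices (Suc n). kron A (replicate (Suc n) i) js * f js) =
      (\<Sum>l\<in>UNIV. A $ i $ l * (\<Sum>js\<in>multi_indices n. kron A (replicate n i) js * f (l # js)))"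
    by (simp add: sum_multi_indices_Suc sum_distrib_left mult.assoc)
  also have "\<dots> = (\<Sum>l\<in>UNIV. A $ i $ l * ((A $ i $ i) ^ n * f (l # replicate n i)))"
    by (simp add: Suc.IH)
  also have "\<dots> = (\<Sum>l\<in>UNIV. if l = i then (A $ i $ i) ^ Suc n * f (i # replicate n i) else 0)"
    using A src by (intro sum.cong) (auto simp: edge_matrices_def)
  finally show ?case by simp
qed

section \<open>Entries with \<open>n\<close> trailing copies of a source\<close>

context
  fixes A :: "real^'n^'n" and i :: 'n and n :: nat and w :: "real^'n"
  assumes A: "A \<in> edge_matrices E" and diag: "\<And>j. \<bar>A $ j $ j\<bar> < 1"
    and src: "\<And>l. (l, i) \<in> E \<Longrightarrow> l = i" and n: "n > 0"
begin

private abbreviation (input) T where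
  "T l \<equiv> lyapunov_solution (Suc n) A w (l # replicate n i)"

text \<open>The trailing modes contract to the scalar \<open>(A $ i $ i) ^ n\<close>, leaving a
  linear equation in one free index. As \<open>n > 0\<close>, noise enters only at
  \<open>j = i\<close>.\<close>

lemma lyapunov_source_eq:
  "T j = (A $ i $ i) ^ n * (\<Sum>l\<in>UNIV. A $ j $ l * T l) + (if j = i then w $ i else 0)"
proof -
  have "diagonal_tensor (Suc n) w (j # replicate n i) = (if j = i then w $ i else 0)"
    using n by (cases n) (auto simp: diagonal_tensor_def)
  moreover have "(\<Sum>js\<in>multi_indices (Suc n).
      kron A (j # replicate n i) js * lyapunov_solution (Suc n) A w js) =
      (\<Sum>l\<in>UNIV. A $ j $ l * (\<Sum>js\<in>multi_indices n.
        kron A (replicate n i) js * lyapunov_solution (Suc n) A w (l # js)))"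
    by (simp add: sum_multi_indices_Suc sum_distrib_left mult.assoc)
  ultimately show ?thesis
    using lyapunov_solution_eq[OF A diag, of "Suc n" "j # replicate n i" w]
    by (simp add: sum_kron_source[OF A src] sum_distrib_left mult_ac)
qed

lemma lyapunov_source_self: "T i * (1 - (A $ i $ i) ^ Suc n) = w $ i"
proof -
  have "(\<Sum>l\<in>UNIV. A $ i $ l * T l) = (\<Sum>l\<in>UNIV. if l = i then A $ i $ i * T i else 0)"
    using A src by (intro sum.cong) (auto simp: edge_matrices_def)
  then have sum_eq: "(\<Sum>l\<in>UNIV. A $ i $ l * T l) = A $ i $ i * T i" by simp
  from lyapunov_source_eq[of i] show ?thesis
    unfolding sum_eq by (simp add: algebra_simps)
qed

private lemma damping: "1 - (A $ i $ i) ^ n * A $ l $ l \<noteq> 0"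
proof -
  have "\<bar>(A $ i $ i) ^ n * A $ l $ l\<bar> < 1"
    using abs_kron_diag_less_one[of A "l # replicate n i", OF diag]
    by (simp add: kron_replicate mult.commute)
  then show ?thesis by linarith
qed

text \<open>No parent of an unreachable node is reachable, so by induction its equation reduces to
  the loop term, whose coefficient is non-zero by \<open>damping\<close>.\<close>

lemma lyapunov_source_nondescendant: "(i, l) \<notin> E\<^sup>* \<Longrightarrow> T l = 0"
proof (induction l rule: measure_induct_rule[of h])
  case (less l)
  have "l \<noteq> i" using less.prems by auto
  have term_eq: "A $ l $ l' * T l' = (if l' = l then A $ l $ l * T l else 0)" for l'
  proof (cases "(l', l) \<in> E \<and> l' \<noteq> l")
    case True
    then have "(i, l') \<notin> E\<^sup>*" using less.prems by (meson rtrancl.rtrancl_into_rtrancl)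
    then show ?thesis using less.IH[of l'] True h_less by simp
  next
    case False
    then show ?thesis using A by (auto simp: edge_matrices_def)
  qed
  have "(\<Sum>l'\<in>UNIV. A $ l $ l' * T l') =
      (\<Sum>l'\<in>UNIV. if l' = l then A $ l $ l * T l else 0)"
    by (intro sum.cong refl term_eq)
  then have sum_eq: "(\<Sum>l'\<in>UNIV. A $ l $ l' * T l') = A $ l $ l * T l" by simp
  from lyapunov_source_eq[of l] have "T l * (1 - (A $ i $ i) ^ n * A $ l $ l) = 0"
    unfolding sum_eq using \<open>l \<noteq> i\<close> by (simp add: algebra_simps)
  then show ?case using damping by simp
qed

text \<open>The assumption \<open>par\<close> is met by a lowest child of \<open>i\<close>: the
  entries of its other parents vanish and a two-node equation remains.\<close>

lemma lyapunov_source_child: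
  assumes "(i, j) \<in> E" and "i \<noteq> j"
    and par: "\<And>l. (l, j) \<in> E \<Longrightarrow> l \<noteq> i \<Longrightarrow> l \<noteq> j \<Longrightarrow> (i, l) \<notin> E\<^sup>*"
  shows "T j * (1 - (A $ i $ i) ^ n * A $ j $ j) = (A $ i $ i) ^ n * A $ j $ i * T i"
proof -
  have term_eq: "A $ j $ l * T l = (if l = i then A $ j $ i * T i else 0) +
      (if l = j then A $ j $ j * T j else 0)" for l
    using A par[of l] lyapunov_source_nondescendant[of l] \<open>i \<noteq> j\<close>
    by (cases "(l, j) \<in> E") (auto simp: edge_matrices_def)
  have "(\<Sum>l\<in>UNIV. A $ j $ l * T l) = (\<Sum>l\<in>UNIV.
      (if l = i then A $ j $ i * T i else 0) + (if l = j then A $ j $ j * T j else 0))"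
    by (intro sum.cong refl term_eq)
  then have sum_eq: "(\<Sum>l\<in>UNIV. A $ j $ l * T l) = A $ j $ i * T i + A $ j $ j * T j"
    by (simp add: sum.distrib)
  from lyapunov_source_eq[of j] show ?thesis
    unfolding sum_eq using \<open>i \<noteq> j\<close> by (simp add: algebra_simps)
qed

end

end

section \<open>Recovering a source weight from three ratios\<close>

text \<open>\<open>u\<close>, \<open>v\<close>, \<open>w\<close> are the ratios for
  \<open>n = 1, 2, 3\<close>. With \<open>y = 1 / x\<close> the equations read
  \<open>b / u = y - c\<close>, \<open>b / v = y ^ 2 - c\<close>, \<open>b / w = y ^ 3 - c\<close>.
  Differences remove \<open>c\<close>, and the second difference is \<open>y\<close> times the
  first.\<close>

lemma two_node_ratio:
  fixes x c b u v w :: real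
  assumes "0 < \<bar>x\<bar>" "\<bar>x\<bar> < 1"
    and u: "u * (1 - x * c) = x * b" and v: "v * (1 - x ^ 2 * c) = x ^ 2 * b"
    and w: "w * (1 - x ^ 3 * c) = x ^ 3 * b"
    and nz: "u \<noteq> 0" "v \<noteq> 0" "w \<noteq> 0"
  shows "1 / u \<noteq> 1 / v" and "x * (1 / w - 1 / v) = 1 / v - 1 / u"
proof -
  have x: "x \<noteq> 0" "x \<noteq> 1" using assms(1,2) by auto
  define y where "y = 1 / x"
  have y: "y \<noteq> 0" "y \<noteq> 1" "x * y = 1" using x by (auto simp: y_def)
  \<comment> \<open>Deduced from the ratios, because a competing parameter tuple may a priori have
    edge weight zero. With \<open>b = 0\<close> the first two equations would give
    \<open>x * c = 1\<close> and \<open>x ^ 2 * c = 1\<close>, hence \<open>x = 1\<close>.\<close>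
  have "b \<noteq> 0"
  proof
    assume "b = 0"
    then have "x * c = 1" "x * (x * c) = 1"
      using u v nz by (auto simp: power2_eq_square mult.assoc)
    then show False using x by simp
  qed
  have "y - c = b / u" "y ^ 2 - c = b / v" "y ^ 3 - c = b / w"
    using u v w nz x unfolding y_def by (simp_all add: field_simps)
  then have 1: "b * (1 / v - 1 / u) = y * (y - 1)" and 2: "b * (1 / w - 1 / v) = y ^ 2 * (y - 1)"
    by (simp_all add: algebra_simps power2_eq_square power3_eq_cube)
  from 1 y show "1 / u \<noteq> 1 / v" by auto
  have "b * (x * (1 / w - 1 / v)) = x * (b * (1 / w - 1 / v))" by (rule mult.left_commute)
  also have "\<dots> = (x * y) * (y * (y - 1))"
    unfolding 2 by (simp only: power2_eq_square mult.assoc)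
  also have "\<dots> = b * (1 / v - 1 / u)" by (simp add: 1 y)
  finally show "x * (1 / w - 1 / v) = 1 / v - 1 / u"
    using \<open>b \<noteq> 0\<close> by (metis mult_left_cancel)
qed

text \<open>The ratios \<open>s1 n / s0 n\<close> are common to both parameter tuples, so
  \<open>x\<close> and \<open>x'\<close> solve the same linear equation. Its right-hand side is
  non-zero, which makes its coefficient non-zero too.\<close>

lemma two_node_identifiable:
  fixes x c b x' c' b' :: real and s0 s1 :: "nat \<Rightarrow> real"
  assumes x: "0 < \<bar>x\<bar>" "\<bar>x\<bar> < 1" and x': "0 < \<bar>x'\<bar>" "\<bar>x'\<bar> < 1"
    and s: "\<And>n. n \<in> {1, 2, 3} \<Longrightarrow> s1 n * (1 - x ^ n * c) = x ^ n * b * s0 n"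
    and s': "\<And>n. n \<in> {1, 2, 3} \<Longrightarrow> s1 n * (1 - x' ^ n * c') = x' ^ n * b' * s0 n"
    and s0: "\<And>n. n \<in> {1, 2, 3} \<Longrightarrow> s0 n \<noteq> 0"
    and "b \<noteq> 0"
  shows "x = x'"
proof -
  define r where "r n = s1 n / s0 n" for n
  have r: "r n * (1 - x ^ n * c) = x ^ n * b" and r': "r n * (1 - x' ^ n * c') = x' ^ n * b'"
    if "n \<in> {1, 2, 3}" for n
    using s[OF that] s'[OF that] s0[OF that] by (simp_all add: r_def field_simps)
  have "r n \<noteq> 0" if "n \<in> {1, 2, 3}" for n
    using r[OF that] \<open>b \<noteq> 0\<close> x(1) by auto
  then have nz: "r 1 \<noteq> 0" "r 2 \<noteq> 0" "r 3 \<noteq> 0" by simp_all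
  have "x * (1 / r 3 - 1 / r 2) = 1 / r 2 - 1 / r 1" and "1 / r 1 \<noteq> 1 / r 2"
    using two_node_ratio[OF x _ _ _ nz, of c b] r[of 1] r[of 2] r[of 3] by simp_all
  moreover have "x' * (1 / r 3 - 1 / r 2) = 1 / r 2 - 1 / r 1"
    using two_node_ratio[OF x' _ _ _ nz, of c' b'] r'[of 1] r'[of 2] r'[of 3] by simp_all
  ultimately show ?thesis by (metis diff_eq_eq eq_iff_diff_eq_0 mult_cancel_right mult_zero_right)
qed

text \<open>
  The rows outside \<open>insert k P\<close> are those of the identity matrix. They encode that row \<open>k\<close> of \<open>A\<close> is
  supported on \<open>insert k P\<close> and keep the system square over the whole node type.
\<close>

definition cumulant_matrix :: "'n::finite set \<Rightarrow> 'n \<Rightarrow> 'n \<Rightarrow> 'n params \<Rightarrow> real^'n^'n" where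
  "cumulant_matrix P i k = (\<lambda>(A, w2, w3, w4). \<chi> j l.
     if j = k then lyapunov_solution 3 A w3 [l, i, i]
     else if j \<in> P then lyapunov_solution 2 A w2 [l, j]
     else if l = j then 1 else 0)"

context graded_graph
begin

text \<open>Equal cumulants give equal ratios for \<open>n = 1, 2, 3\<close>, with non-zero
  denominators because the noise of \<open>i\<close> is non-zero.\<close>

lemma source_weight_eq:
  assumes \<theta>: "(A, w2, w3, w4) \<in> parameter_space E"
    and \<theta>': "(A', w2', w3', w4') \<in> parameter_space E"
    and eq: "cumulants (A', w2', w3', w4') = cumulants (A, w2, w3, w4)"
    and src: "\<And>l. (l, i) \<in> E \<Longrightarrow> l = i"
    and j: "(i, j) \<in> E" "i \<noteq> j"
      "\<And>l. (l, j) \<in> E \<Longrightarrow> l \<noteq> i \<Longrightarrow> l \<noteq> j \<Longrightarrow> (i, l) \<notin> E\<^sup>*"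
    and nz: "A $ j $ i \<noteq> 0"
  shows "A' $ i $ i = A $ i $ i"
proof -
  note [simp] = mem_parameter_space_iff
  \<comment> \<open>Here \<open>n\<close> counts the trailing copies of \<open>i\<close>, so it
    belongs to the cumulant of order \<open>Suc n\<close>.\<close>
  define w where "w n = (if n = 1 then w2 else if n = 2 then w3 else w4)" for n :: nat
  define w' where "w' n = (if n = 1 then w2' else if n = 2 then w3' else w4')" for n :: nat
  define T where "T n l = lyapunov_solution (Suc n) A (w n) (l # replicate n i)" for n l
  have T': "T n l = lyapunov_solution (Suc n) A' (w' n) (l # replicate n i)"
    if "n \<in> {1, 2, 3}" for n l
    using that eq by (auto simp: T_def w_def w'_def cumulants_def eval_nat_numeral)
  have A: "A \<in> edge_matrices E" "\<And>j. \<bar>A $ j $ j\<bar> < 1"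
    and A': "A' \<in> edge_matrices E" "\<And>j. \<bar>A' $ j $ j\<bar> < 1"
    using \<theta> \<theta>' by auto
  have "T n i \<noteq> 0" if "n \<in> {1, 2, 3}" for n
  proof -
    have "w n $ i \<noteq> 0" using \<theta> by (auto simp: w_def less_imp_neq[THEN not_sym])
    then show ?thesis
      using lyapunov_source_self[OF A src, of n "w n"] that by (auto simp: T_def)
  qed
  moreover have "T n j * (1 - (A $ i $ i) ^ n * A $ j $ j) = (A $ i $ i) ^ n * A $ j $ i * T n i"
    if "n \<in> {1, 2, 3}" for n
    unfolding T_def by (rule lyapunov_source_child[OF A src _ j]) (use that in auto)
  moreover have "T n j * (1 - (A' $ i $ i) ^ n * A' $ j $ j) =
      (A' $ i $ i) ^ n * A' $ j $ i * T n i"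
    if "n \<in> {1, 2, 3}" for n
    unfolding T'[OF that] by (rule lyapunov_source_child[OF A' src _ j]) (use that in auto)
  moreover have "0 < \<bar>A $ i $ i\<bar>" "\<bar>A $ i $ i\<bar> < 1" "0 < \<bar>A' $ i $ i\<bar>" "\<bar>A' $ i $ i\<bar> < 1"
    using \<theta> \<theta>' by auto
  ultimately show ?thesis
    using two_node_identifiable[of "A $ i $ i" "A' $ i $ i" "\<lambda>n. T n j" "A $ j $ j" "A $ j $ i"
        "\<lambda>n. T n i" "A' $ j $ j" "A' $ j $ i"] nz by simp
qed

section \<open>Nodes with parents\<close>

text \<open>As \<open>P\<close> is closed under parents, rows of the Kronecker power indexed by
  nodes of \<open>P\<close> vanish at columns that leave \<open>P\<close>. The remaining block is
  triangular in height with non-zero diagonal, so it can be cancelled.\<close>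

lemma kron_injective:
  assumes A: "A \<in> edge_matrices E" and nz: "\<And>i. i \<in> P \<Longrightarrow> A $ i $ i \<noteq> 0"
    and P: "\<And>u v. (u, v) \<in> E \<Longrightarrow> v \<in> P \<Longrightarrow> u \<in> P"
    and 0: "\<And>is. length is = n \<Longrightarrow> set is \<subseteq> P \<Longrightarrow> (\<Sum>js\<in>multi_indices n. kron A is js * d js) = 0"
    and "length is = n" "set is \<subseteq> P"
  shows "d is = 0"
  using assms(5,6)
proof (induction "is" rule: measure_induct_rule[of height])
  case (less "is")
  have edge: "(j, i) \<in> E" if "A $ i $ j \<noteq> 0" for i j
    using that A by (auto simp: edge_matrices_def)
  have closed: "set js \<subseteq> P" if "length is = length js" "kron A is js \<noteq> 0" "set is \<subseteq> P" for "is" js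
    using that by (induction "is" js rule: list_induct2) (auto intro: P edge)
  have "(if height js < height is then kron A is js * d js else 0) = 0"
    if "length js = n" for js
    using less.IH[of js] closed[of "is" js] less.prems that
    by (cases "kron A is js = 0") simp_all
  then have "kron A is is * d is = 0"
    using sum_kron_split[OF A, of "is" d] 0[of "is"] less.prems by simp
  moreover have "kron A is is \<noteq> 0"
    using nz less.prems by (intro kron_diag_nonzero) auto
  ultimately show ?case by simp
qed

text \<open>For \<open>is\<close> in \<open>P\<close> the multi-index \<open>k # is\<close> is off
  the diagonal, so its equation contains no noise; the known rows act on the tail and row
  \<open>k\<close> enters linearly. The equations of \<open>A\<close> and \<open>A'\<close> are
  subtracted and the tail is cancelled by \<open>kron_injective\<close>.\<close>

lemma row_difference_orthogonal:
  assumes A: "A \<in> edge_matrices E" "\<And>i. \<bar>A $ i $ i\<bar> < 1"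
    and A': "A' \<in> edge_matrices E" "\<And>i. \<bar>A' $ i $ i\<bar> < 1"
    and nz: "\<And>i. i \<in> P \<Longrightarrow> A $ i $ i \<noteq> 0"
    and P: "\<And>u v. (u, v) \<in> E \<Longrightarrow> v \<in> P \<Longrightarrow> u \<in> P" and k: "k \<notin> P"
    and rows: "\<And>i. i \<in> P \<Longrightarrow> A' $ i = A $ i"
    and eq: "lyapunov_solution (Suc n) A' w' = lyapunov_solution (Suc n) A w"
    and js: "n > 0" "length js = n" "set js \<subseteq> P"
  shows "(\<Sum>l\<in>UNIV. (A' $ k $ l - A $ k $ l) * lyapunov_solution (Suc n) A w (l # js)) = 0"
proof -
  define T where "T = lyapunov_solution (Suc n) A w"
  \<comment> \<open>Stated for any \<open>B\<close> that agrees with \<open>A\<close> on the rows of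
    \<open>P\<close>, so that \<open>A\<close> and \<open>A'\<close> get the same Kronecker
    factor.\<close>
  have row: "T (k # is) =
      (\<Sum>js\<in>multi_indices n. kron A is js * (\<Sum>l\<in>UNIV. B $ k $ l * T (l # js)))"
    if B: "B \<in> edge_matrices E" "\<And>i. \<bar>B $ i $ i\<bar> < 1" "\<And>i. i \<in> P \<Longrightarrow> B $ i = A $ i"
      "T = lyapunov_solution (Suc n) B v" and idx: "length is = n" "set is \<subseteq> P" for B v "is"
  proof -
    have kron_eq: "kron B is js = kron A is js" if "length js = n" for js
    proof -
      have "length is = length js" using idx that by simp
      then show ?thesis using idx(2)
        by (induction "is" js rule: list_induct2) (simp_all add: B(3))
    qed
    have "diagonal_tensor (Suc n) v (k # is) = 0"
      using idx js(1) k by (cases "is") (auto simp: diagonal_tensor_def)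
    then have "T (k # is) = (\<Sum>js\<in>multi_indices (Suc n). kron B (k # is) js * T js)"
      using lyapunov_solution_eq[OF B(1,2), of "Suc n" "k # is" v] idx
      unfolding B(4) by simp
    also have "\<dots> = (\<Sum>l\<in>UNIV. \<Sum>js\<in>multi_indices n. kron A is js * (B $ k $ l * T (l # js)))"
      by (simp add: sum_multi_indices_Suc kron_eq mult_ac)
    also have "\<dots> = (\<Sum>js\<in>multi_indices n. \<Sum>l\<in>UNIV. kron A is js * (B $ k $ l * T (l # js)))"
      by (rule sum.swap)
    finally show ?thesis by (simp add: sum_distrib_left)
  qed
  have "(\<Sum>l\<in>UNIV. (A' $ k $ l - A $ k $ l) * T (l # js)) = 0"
  proof (rule kron_injective[where d = "\<lambda>js. \<Sum>l\<in>UNIV. (A' $ k $ l - A $ k $ l) * T (l # js)",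
        OF A(1) nz P _ js(2,3)])
    fix "is" assume idx: "length is = n" "set is \<subseteq> P"
    have "T (k # is) = (\<Sum>js\<in>multi_indices n. kron A is js * (\<Sum>l\<in>UNIV. A $ k $ l * T (l # js)))"
      using A idx by (intro row[of A w]) (auto simp: T_def)
    moreover have "T (k # is) =
        (\<Sum>js\<in>multi_indices n. kron A is js * (\<Sum>l\<in>UNIV. A' $ k $ l * T (l # js)))"
      using A' rows idx eq by (intro row[of A' w']) (auto simp: T_def)
    ultimately show "(\<Sum>js\<in>multi_indices n.
        kron A is js * (\<Sum>l\<in>UNIV. (A' $ k $ l - A $ k $ l) * T (l # js))) = 0"
      by (simp add: left_diff_distrib right_diff_distrib sum_subtractf)
  qed
  then show ?thesis by (simp add: T_def)
qed

text \<open>The difference of the two rows lies in the kernel of \<open>cumulant_matrix\<close>: its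
  rows in \<open>P\<close> give the orthogonality relations for \<open>S\<close>, row
  \<open>k\<close> gives that for \<open>T\<close> at \<open>[i, i]\<close>, and the others express
  the zero pattern.\<close>

lemma row_eq:
  assumes \<theta>: "(A, w2, w3, w4) \<in> parameter_space E"
    and \<theta>': "(A', w2', w3', w4') \<in> parameter_space E"
    and eq: "cumulants (A', w2', w3', w4') = cumulants (A, w2, w3, w4)"
    and P: "\<And>u v. (u, v) \<in> E \<Longrightarrow> v \<in> P \<Longrightarrow> u \<in> P" and k: "k \<notin> P"
    and parents: "\<And>u. (u, k) \<in> E \<Longrightarrow> u \<in> insert k P"
    and rows: "\<And>j. j \<in> P \<Longrightarrow> A' $ j = A $ j" and i: "i \<in> P"
    and det: "det (cumulant_matrix P i k (A, w2, w3, w4)) \<noteq> 0"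
  shows "A' $ k = A $ k"
proof -
  define M where "M = cumulant_matrix P i k (A, w2, w3, w4)"
  define d where "d = A' $ k - A $ k"
  have A: "A \<in> edge_matrices E" "\<And>j. \<bar>A $ j $ j\<bar> < 1" "\<And>j. A $ j $ j \<noteq> 0"
    and A': "A' \<in> edge_matrices E" "\<And>j. \<bar>A' $ j $ j\<bar> < 1"
    using \<theta> \<theta>' by (auto simp: mem_parameter_space_iff)
  have S: "lyapunov_solution (Suc 1) A' w2' = lyapunov_solution (Suc 1) A w2"
    and T: "lyapunov_solution (Suc 2) A' w3' = lyapunov_solution (Suc 2) A w3"
    using eq by (simp_all add: cumulants_def eval_nat_numeral)
  have "(M *v d) $ j = 0" for j
  proof -
    have d: "d $ l = A' $ k $ l - A $ k $ l" for l by (simp add: d_def)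
    have "(M *v d) $ k = 0"
      using row_difference_orthogonal[OF A(1,2) A' A(3) P k rows T, where js = "[i, i]"] i
      by (simp add: matrix_vector_mult_def M_def cumulant_matrix_def d mult_ac eval_nat_numeral)
    moreover have "(M *v d) $ j = 0" if "j \<in> P" "j \<noteq> k"
      using row_difference_orthogonal[OF A(1,2) A' A(3) P k rows S, where js = "[j]"] that
      by (simp add: matrix_vector_mult_def M_def cumulant_matrix_def d mult_ac eval_nat_numeral)
    moreover have "(M *v d) $ j = 0" if "j \<notin> P" "j \<noteq> k"
    proof -
      have "(j, k) \<notin> E" using parents that by auto
      then have "d $ j = 0" using A(1) A'(1) by (auto simp: d edge_matrices_def)
      have "(M *v d) $ j = (\<Sum>l\<in>UNIV. (if l = j then 1 else 0) * d $ l)"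
        using that by (simp add: matrix_vector_mult_def M_def cumulant_matrix_def)
      also have "\<dots> = (\<Sum>l\<in>UNIV. if l = j then d $ l else 0)"
        by (intro sum.cong) auto
      finally have "(M *v d) $ j = (\<Sum>l\<in>UNIV. if l = j then d $ l else 0)" .
      with \<open>d $ j = 0\<close> show ?thesis by simp
    qed
    ultimately show ?thesis by blast
  qed
  then have "M *v d = 0" by (simp add: vec_eq_iff)
  then have "d = 0"
    using det unfolding M_def[symmetric]
    by (metis invertible_det_nz matrix_left_invertible_ker invertible_left_inverse)
  then show ?thesis by (simp add: d_def)
qed

end

section \<open>Rational dependence on the parameters\<close>

text \<open>The denominator has no zeros on \<open>S\<close>, so within \<open>S\<close> the zeros
  of \<open>g\<close> are those of the polynomial \<open>p\<close>. This makes the exceptional sets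
  algebraic.\<close>

definition rational_on :: "'a::real_normed_vector set \<Rightarrow> ('a \<Rightarrow> real) \<Rightarrow> bool" where
  "rational_on S g \<longleftrightarrow> (\<exists>p q. real_polynomial_function p \<and> real_polynomial_function q \<and>
     (\<forall>x\<in>S. q x \<noteq> 0 \<and> g x = p x / q x))"

lemma rational_onE:
  assumes "rational_on S g"
  obtains p q where "real_polynomial_function p" "real_polynomial_function q"
    "\<And>x. x \<in> S \<Longrightarrow> q x \<noteq> 0" "\<And>x. x \<in> S \<Longrightarrow> g x = p x / q x"
  using assms by (auto simp: rational_on_def)

lemma rational_on_cong: "(\<And>x. x \<in> S \<Longrightarrow> f x = g x) \<Longrightarrow> rational_on S f \<longleftrightarrow> rational_on S g"
  by (simp add: rational_on_def)

lemma rational_on_polynomial: "real_polynomial_function p \<Longrightarrow> rational_on S p"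
  unfolding rational_on_def by (intro exI[of _ p] exI[of _ "\<lambda>_. 1"]) auto

lemma rational_on_const: "rational_on S (\<lambda>_. c)"
  by (intro rational_on_polynomial) auto

lemma rational_on_mult:
  assumes "rational_on S f" "rational_on S g"
  shows "rational_on S (\<lambda>x. f x * g x)"
proof -
  from assms obtain p q p' q' where
    "real_polynomial_function p" "real_polynomial_function q"
    "real_polynomial_function p'" "real_polynomial_function q'"
    "\<And>x. x \<in> S \<Longrightarrow> q x \<noteq> 0 \<and> q' x \<noteq> 0" "\<And>x. x \<in> S \<Longrightarrow> f x = p x / q x \<and> g x = p' x / q' x"
    by (metis rational_onE)
  then show ?thesis
    unfolding rational_on_def
    by (intro exI[of _ "\<lambda>x. p x * p' x"] exI[of _ "\<lambda>x. q x * q' x"]) auto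
qed

lemma rational_on_add:
  assumes "rational_on S f" "rational_on S g"
  shows "rational_on S (\<lambda>x. f x + g x)"
proof -
  from assms obtain p q p' q' where
    "real_polynomial_function p" "real_polynomial_function q"
    "real_polynomial_function p'" "real_polynomial_function q'"
    "\<And>x. x \<in> S \<Longrightarrow> q x \<noteq> 0 \<and> q' x \<noteq> 0" "\<And>x. x \<in> S \<Longrightarrow> f x = p x / q x \<and> g x = p' x / q' x"
    by (metis rational_onE)
  then show ?thesis
    unfolding rational_on_def
    by (intro exI[of _ "\<lambda>x. p x * q' x + p' x * q x"] exI[of _ "\<lambda>x. q x * q' x"])
      (auto simp: add_frac_eq)
qed

lemma rational_on_divide_polynomial:
  assumes "rational_on S f" "real_polynomial_function g" "\<And>x. x \<in> S \<Longrightarrow> g x \<noteq> 0"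
  shows "rational_on S (\<lambda>x. f x / g x)"
proof -
  have "rational_on S (\<lambda>x. 1 / g x)"
    unfolding rational_on_def using assms(2,3)
    by (intro exI[of _ "\<lambda>_. 1"] exI[of _ g]) auto
  from rational_on_mult[OF assms(1) this] show ?thesis by simp
qed

lemma rational_on_sum: "(\<And>i. i \<in> I \<Longrightarrow> rational_on S (f i)) \<Longrightarrow> rational_on S (\<lambda>x. \<Sum>i\<in>I. f i x)"
  by (induction I rule: infinite_finite_induct) (simp_all add: rational_on_const rational_on_add)

lemma rational_on_prod: "(\<And>i. i \<in> I \<Longrightarrow> rational_on S (f i)) \<Longrightarrow> rational_on S (\<lambda>x. \<Prod>i\<in>I. f i x)"
  by (induction I rule: infinite_finite_induct) (simp_all add: rational_on_const rational_on_mult)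

lemma rational_on_det:
  assumes "\<And>i j. rational_on S (\<lambda>x. M x $ i $ j)"
  shows "rational_on S (\<lambda>x. det (M x))"
  unfolding det_def
  by (intro rational_on_sum rational_on_mult rational_on_prod rational_on_const assms)

lemma polynomial_fst_nth: "real_polynomial_function (\<lambda>\<theta>::'n::finite params. fst \<theta> $ i $ j)"
  by (rule real_polynomial_function.intros(1), rule bounded_linear_compose[OF bounded_linear_vec_nth
      bounded_linear_compose[OF bounded_linear_vec_nth bounded_linear_fst]])

lemma polynomial_kron:
  "length is = length js \<Longrightarrow> real_polynomial_function (\<lambda>\<theta>::'n::finite params. kron (fst \<theta>) is js)"
  by (induction "is" js rule: list_induct2) (auto intro: polynomial_fst_nth)

context graded_graph
begin

text \<open>Induction on height along \<open>lyapunov_solution_rec\<close>, whose denominators are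
  polynomials without zeros on the parameter space.\<close>

lemma rational_lyapunov_solution:
  assumes w: "\<And>i. real_polynomial_function (\<lambda>\<theta>::'n params. w \<theta> $ i)" and "is \<noteq> []"
  shows "rational_on (parameter_space E)
    (\<lambda>\<theta>. lyapunov_solution (length is) (fst \<theta>) (w \<theta>) is)"
  using assms(2)
proof (induction "is" rule: measure_induct_rule[of height])
  case (less "is")
  have \<theta>: "fst \<theta> \<in> edge_matrices E" "\<bar>fst \<theta> $ i $ i\<bar> < 1" if "\<theta> \<in> parameter_space E" for \<theta> i
    using that by (cases \<theta>; simp add: mem_parameter_space_iff)+
  have "rational_on (parameter_space E) (\<lambda>\<theta>. (diagonal_tensor (length is) (w \<theta>) is +
    (\<Sum>js\<in>multi_indices (length is). if height js < height is
      then kron (fst \<theta>) is js * lyapunov_solution (length is) (fst \<theta>) (w \<theta>) js else 0)) /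
      (1 - kron (fst \<theta>) is is))" (is "rational_on _ ?rhs")
  proof (intro rational_on_divide_polynomial rational_on_add rational_on_sum)
    show "rational_on (parameter_space E) (\<lambda>\<theta>. diagonal_tensor (length is) (w \<theta>) is)"
      by (cases "\<exists>i. is = replicate (length is) i")
        (auto simp: diagonal_tensor_def rational_on_const intro!: rational_on_polynomial w)
    show "real_polynomial_function (\<lambda>\<theta>::'n params. 1 - kron (fst \<theta>) is is)"
      by (intro real_polynomial_function_diff polynomial_kron) auto
    show "1 - kron (fst \<theta>) is is \<noteq> 0" if "\<theta> \<in> parameter_space E" for \<theta>
      using abs_kron_diag_less_one[of "fst \<theta>" "is", OF \<theta>(2)[OF that]] less.prems by linarith
    fix js :: "'n list" assume "js \<in> multi_indices (length is)"
    then have js: "length js = length is" "js \<noteq> []" using less.prems by auto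
    then show "rational_on (parameter_space E) (\<lambda>\<theta>. if height js < height is
      then kron (fst \<theta>) is js * lyapunov_solution (length is) (fst \<theta>) (w \<theta>) js else 0)"
      using less.IH[of js]
      by (cases "height js < height is")
        (simp_all add: rational_on_const rational_on_mult rational_on_polynomial polynomial_kron)
  qed
  moreover have "lyapunov_solution (length is) (fst \<theta>) (w \<theta>) is = ?rhs \<theta>"
    if "\<theta> \<in> parameter_space E" for \<theta>
    using \<theta>[OF that] less.prems by (intro lyapunov_solution_rec)
  ultimately show ?case using rational_on_cong by (metis (no_types, lifting))
qed

lemma rational_det_cumulant_matrix:
  "rational_on (parameter_space E) (\<lambda>\<theta>. det (cumulant_matrix P i k \<theta>))"
proof (rule rational_on_det)
  fix j l
  have "bounded_linear (\<lambda>\<theta>::'n params. fst (snd \<theta>) $ i)"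
    and "bounded_linear (\<lambda>\<theta>::'n params. fst (snd (snd \<theta>)) $ i)" for i
    by (intro bounded_linear_compose[OF bounded_linear_vec_nth]
        bounded_linear_fst_comp bounded_linear_snd_comp bounded_linear_snd bounded_linear_ident)+
  then have "rational_on (parameter_space E)
      (\<lambda>\<theta>. lyapunov_solution (length [l, j]) (fst \<theta>) (fst (snd \<theta>)) [l, j])"
    and "rational_on (parameter_space E)
      (\<lambda>\<theta>. lyapunov_solution (length [l, i, i]) (fst \<theta>) (fst (snd (snd \<theta>))) [l, i, i])"
    by (intro rational_lyapunov_solution[where w = "\<lambda>\<theta>. fst (snd \<theta>)"]
        rational_lyapunov_solution[where w = "\<lambda>\<theta>. fst (snd (snd \<theta>))"]
        real_polynomial_function.intros(1); simp)+
  then show "rational_on (parameter_space E) (\<lambda>\<theta>. cumulant_matrix P i k \<theta> $ j $ l)"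
    by (cases "j = k"; cases "j \<in> P"; cases "l = j")
      (simp_all add: cumulant_matrix_def case_prod_unfold eval_nat_numeral rational_on_const)
qed

section \<open>Common non-vanishing of polynomials on the parameter space\<close>

text \<open>
  The parameter space is not convex, but near \<open>\<theta>1\<close> the line through \<open>\<theta>1\<close> and \<open>\<theta>2\<close> stays in it, and
  each polynomial has only finitely many zeros on that line.
\<close>

lemma parameter_space_nonvanishing:
  assumes f: "real_polynomial_function f" "\<theta>1 \<in> parameter_space E" "f \<theta>1 \<noteq> 0"
    and g: "real_polynomial_function g" "\<theta>2 \<in> parameter_space E" "g \<theta>2 \<noteq> 0"
  shows "\<exists>\<theta> \<in> parameter_space E. f \<theta> * g \<theta> \<noteq> 0"
proof -
  define \<gamma> where "\<gamma> t = \<theta>1 + t *\<^sub>R (\<theta>2 - \<theta>1)" for t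
  have \<gamma>01: "\<gamma> 0 = \<theta>1" "\<gamma> 1 = \<theta>2" by (simp_all add: \<gamma>_def)
  have "polynomial_function \<gamma>"
    unfolding \<gamma>_def by (intro polynomial_function_add polynomial_function_mult
        polynomial_function_const) simp_all
  \<comment> \<open>A non-zero value at any one \<open>s\<close> on the line excludes the zero
    polynomial; it is \<open>s = 0\<close> for \<open>f\<close> and \<open>s = 1\<close> for
    \<open>g\<close>.\<close>
  have nonzero: "eventually (\<lambda>t. p (\<gamma> t) \<noteq> 0) (at 0)"
    if p: "real_polynomial_function p" "p (\<gamma> s) \<noteq> 0" for p s
  proof -
    have "real_polynomial_function (\<lambda>t. p (\<gamma> t))"
      using real_polynomial_function_compose[OF \<open>polynomial_function \<gamma>\<close> p(1)] by (simp add: o_def)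
    then obtain a n where a: "(\<lambda>t. p (\<gamma> t)) = (\<lambda>t. \<Sum>i\<le>n. a i * t ^ i)"
      by (auto simp: real_polynomial_function_iff_sum)
    have "\<exists>i\<le>n. a i \<noteq> 0"
    proof (rule ccontr)
      assume "\<not> (\<exists>i\<le>n. a i \<noteq> 0)"
      then have "(\<Sum>i\<le>n. a i * s ^ i) = 0" by (intro sum.neutral) auto
      then show False using p(2) fun_cong[OF a, of s] by simp
    qed
    then have "finite {t. p (\<gamma> t) = 0}"
      unfolding fun_cong[OF a] by (simp add: polyfun_finite_roots)
    then have "\<not> 0 islimpt {t. p (\<gamma> t) = 0}" by (rule islimpt_finite)
    then show ?thesis by (simp add: islimpt_iff_eventually)
  qed
  obtain A w2 w3 w4 A' w2' w3' w4' where \<theta>12: "\<theta>1 = (A, w2, w3, w4)" "\<theta>2 = (A', w2', w3', w4')"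
    by (metis prod_cases4)
  have entry: "((\<lambda>t. x + t * (y - x)) \<longlongrightarrow> x) (at 0)" for x y :: real
    by (auto intro!: tendsto_eq_intros)
  \<comment> \<open>These conditions are open and hold at \<open>t = 0\<close>. The zero pattern is
    linear and persists along the whole line.\<close>
  have "eventually (\<lambda>t. \<forall>i. \<bar>A $ i $ i + t * (A' $ i $ i - A $ i $ i)\<bar> < 1 \<and>
      A $ i $ i + t * (A' $ i $ i - A $ i $ i) \<noteq> 0 \<and>
      w2 $ i + t * (w2' $ i - w2 $ i) > 0 \<and> w3 $ i + t * (w3' $ i - w3 $ i) \<noteq> 0 \<and>
      w4 $ i + t * (w4' $ i - w4 $ i) > 0) (at 0)"
    using f(2) unfolding \<theta>12 mem_parameter_space_iff
    by (intro eventually_all_finite eventually_conj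
        order_tendstoD(1)[OF entry] order_tendstoD(2)[OF tendsto_rabs[OF entry]]
        tendsto_imp_eventually_ne[OF entry]) auto
  then have "eventually (\<lambda>t. \<gamma> t \<in> parameter_space E) (at 0)"
  proof eventually_elim
    case (elim t)
    then show ?case
      using f(2) g(2) unfolding \<theta>12 \<gamma>_def by (simp add: mem_parameter_space_iff edge_matrices_def)
  qed
  moreover have "eventually (\<lambda>t. f (\<gamma> t) \<noteq> 0) (at 0)"
    using nonzero[OF f(1), of 0] f(3) by (simp add: \<gamma>01)
  moreover have "eventually (\<lambda>t. g (\<gamma> t) \<noteq> 0) (at 0)"
    using nonzero[OF g(1), of 1] g(3) by (simp add: \<gamma>01)
  ultimately have "eventually (\<lambda>t. \<gamma> t \<in> parameter_space E \<and> f (\<gamma> t) * g (\<gamma> t) \<noteq> 0) (at 0)"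
    by eventually_elim simp
  then show ?thesis using eventually_happens'[OF at_neq_bot] by blast
qed

lemma parameter_space_prod_nonvanishing:
  assumes "finite I" "I \<noteq> {}" "\<And>i. i \<in> I \<Longrightarrow> real_polynomial_function (f i)"
    and "\<And>i. i \<in> I \<Longrightarrow> \<exists>\<theta> \<in> parameter_space E. f i \<theta> \<noteq> 0"
  shows "\<exists>\<theta> \<in> parameter_space E. (\<Prod>i\<in>I. f i \<theta>) \<noteq> 0"
  using assms
proof (induction I rule: finite_ne_induct)
  case (singleton i)
  then show ?case by simp
next
  case (insert i I)
  obtain \<theta>1 where "\<theta>1 \<in> parameter_space E" "f i \<theta>1 \<noteq> 0"
    using insert.prems(2)[of i] by blast
  moreover obtain \<theta>2 where "\<theta>2 \<in> parameter_space E" "(\<Prod>i\<in>I. f i \<theta>2) \<noteq> 0"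
    using insert.IH insert.prems by blast
  ultimately show ?case
    using parameter_space_nonvanishing[of "f i" \<theta>1 "\<lambda>\<theta>. \<Prod>i\<in>I. f i \<theta>" \<theta>2] insert
    by (simp add: real_polynomial_function_prod)
qed

end

section \<open>Single-edge parameters\<close>

text \<open>A test point for the determinant. Loop weights \<open>1 / 2\<close> are non-zero and
  below 1, which ensures stability whatever the weight of the single edge.\<close>

definition single_edge_matrix :: "'n::finite \<Rightarrow> 'n \<Rightarrow> real^'n^'n" where
  "single_edge_matrix i k = (\<chi> j l. if j = l then 1 / 2 else if j = k \<and> l = i then 1 else 0)"

context graded_graph
begin

lemma single_edge_mem_parameter_space:
  assumes "\<forall>v. (v, v) \<in> E" and "(i, k) \<in> E"
  shows "(single_edge_matrix i k, 1, 1, 1) \<in> parameter_space E"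
  using assms by (auto simp: mem_parameter_space_iff edge_matrices_def single_edge_matrix_def)

text \<open>The system splits into non-zero diagonal entries and a 2 by 2 block for \<open>i\<close>
  and \<open>k\<close>. The block is regular because \<open>S i k / S i i = 2 / 3\<close> differs
  from \<open>T k / T i = 2 / 7\<close>.\<close>

lemma det_cumulant_matrix_single_edge:
  assumes ik: "(i, k) \<in> E" "i \<noteq> k" and P: "i \<in> P" "k \<notin> P"
  shows "det (cumulant_matrix P i k (single_edge_matrix i k, 1, 1, 1)) \<noteq> 0"
proof -
  \<comment> \<open>In this smaller graph every node except \<open>k\<close> is a source, so the
    source lemmas cover all of \<open>P\<close>, including nodes that have other parents in
    \<open>E\<close>.\<close>
  define E0 where "E0 = insert (i, k) Id"
  interpret G: graded_graph E0 h
    using ik h_less by unfold_locales (auto simp: E0_def)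
  define A where "A = single_edge_matrix i k"
  have A: "A \<in> edge_matrices E0" "\<And>j. \<bar>A $ j $ j\<bar> < 1"
    by (auto simp: A_def single_edge_matrix_def edge_matrices_def E0_def)
  have A_nth: "A $ j $ j = 1 / 2" "A $ k $ i = 1" for j
    using ik(2) by (auto simp: A_def single_edge_matrix_def)
  have src: "l = j" if "(l, j) \<in> E0" "j \<noteq> k" for l j
    using that by (auto simp: E0_def)
  have reach: "(j, l) \<notin> E0\<^sup>*" if "l \<noteq> j" "\<not> (j = i \<and> l = k)" for j l
  proof
    assume "(j, l) \<in> E0\<^sup>*"
    then have "l = j \<or> (j = i \<and> l = k)"
      using ik(2) by (induction rule: rtrancl_induct) (auto simp: E0_def)
    with that show False by blast
  qed
  define S where "S j l = lyapunov_solution 2 A 1 [l, j]" for j l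
  define T where "T l = lyapunov_solution 3 A 1 [l, i, i]" for l
  have S0: "S j l = 0" if "j \<noteq> k" "l \<noteq> j" "\<not> (j = i \<and> l = k)" for j l
    using G.lyapunov_source_nondescendant[OF A, of j 1 l 1] reach[OF that(2,3)] src that(1)
    by (auto simp: S_def eval_nat_numeral)
  have T0: "T l = 0" if "l \<noteq> i" "l \<noteq> k" for l
    using G.lyapunov_source_nondescendant[OF A, of i 2 l 1] reach[of l i] src that ik(2)
    by (auto simp: T_def eval_nat_numeral)
  have Sjj: "S j j = 4 / 3" if "j \<noteq> k" for j
    using G.lyapunov_source_self[OF A, of j 1 1] src that
    by (auto simp: S_def A_nth eval_nat_numeral)
  have Ti: "T i = 8 / 7"
    using G.lyapunov_source_self[OF A, of i 2 1] src ik(2)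
    by (auto simp: T_def A_nth eval_nat_numeral)
  have par: "(i, l) \<notin> E0\<^sup>*" if "(l, k) \<in> E0" "l \<noteq> i" "l \<noteq> k" for l
    using that by (auto simp: E0_def)
  have E0: "(i, k) \<in> E0" by (simp add: E0_def)
  have Sk: "S i k = 8 / 9"
    using G.lyapunov_source_child[OF A, of i 1 k 1, OF _ _ E0 ik(2) par] src ik(2) Sjj[of i]
    by (auto simp: S_def A_nth eval_nat_numeral)
  have Tk: "T k = 16 / 49"
    using G.lyapunov_source_child[OF A, of i 2 k 1, OF _ _ E0 ik(2) par] src ik(2) Ti
    by (auto simp: T_def A_nth eval_nat_numeral)
  define M where "M = cumulant_matrix P i k (A, 1, 1, 1)"
  have "d = 0" if "M *v d = 0" for d
  proof -
    have M_sum: "(\<Sum>l\<in>UNIV. M $ j $ l * d $ l) = 0" for j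
      using arg_cong[OF that, of "\<lambda>x. x $ j"] by (simp add: matrix_vector_mult_def)
    have other: "d $ j = 0" if "j \<noteq> i" "j \<noteq> k" for j
    proof -
      have "(\<Sum>l\<in>UNIV. M $ j $ l * d $ l) =
          (\<Sum>l\<in>UNIV. if l = j then (if j \<in> P then 4 / 3 else 1) * d $ j else 0)"
        using that S0[of j] Sjj[of j]
        by (intro sum.cong) (auto simp: M_def cumulant_matrix_def simp flip: S_def)
      then show ?thesis using M_sum[of j] by (simp split: if_splits)
    qed
    have "(\<Sum>l\<in>UNIV. M $ i $ l * d $ l) = (\<Sum>l\<in>UNIV.
        (if l = i then 4 / 3 * d $ i else 0) + (if l = k then 8 / 9 * d $ k else 0))"
      using ik(2) P Sk Sjj[of i] other
      by (intro sum.cong) (auto simp: M_def cumulant_matrix_def simp flip: S_def)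
    then have 1: "4 / 3 * d $ i + 8 / 9 * d $ k = 0" using M_sum[of i] by (simp add: sum.distrib)
    have "(\<Sum>l\<in>UNIV. M $ k $ l * d $ l) = (\<Sum>l\<in>UNIV.
        (if l = i then 8 / 7 * d $ i else 0) + (if l = k then 16 / 49 * d $ k else 0))"
      using ik(2) Ti Tk other
      by (intro sum.cong) (auto simp: M_def cumulant_matrix_def simp flip: T_def)
    then have 2: "8 / 7 * d $ i + 16 / 49 * d $ k = 0" using M_sum[of k] by (simp add: sum.distrib)
    from 1 2 have "d $ i = 0" "d $ k = 0" by linarith+
    with other show "d = 0" by (metis vec_eq_iff zero_index)
  qed
  then show ?thesis
    unfolding M_def A_def
    by (metis invertible_det_nz matrix_left_invertible_ker invertible_left_inverse)
qed

section \<open>A generic condition for each row\<close>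

text \<open>If \<open>k\<close> has a parent, \<open>f\<close> is the numerator of the determinant.
  If \<open>k\<close> is a source, \<open>f\<close> is the weight of the edge to a lowest child,
  which exists as \<open>k\<close> is not isolated. Agreement of the lower rows will be an induction
  hypothesis.\<close>

lemma generic_row_polynomial:
  assumes loops: "\<forall>v. (v, v) \<in> E" and "\<not> isolated_node E k"
  shows "\<exists>f. real_polynomial_function f \<and> (\<exists>\<theta> \<in> parameter_space E. f \<theta> \<noteq> 0) \<and>
    (\<forall>\<theta> \<in> parameter_space E. \<forall>\<theta>' \<in> parameter_space E. f \<theta> \<noteq> 0 \<longrightarrow> cumulants \<theta>' = cumulants \<theta> \<longrightarrow>
      (\<forall>j. h j < h k \<longrightarrow> fst \<theta>' $ j = fst \<theta> $ j) \<longrightarrow> fst \<theta>' $ k = fst \<theta> $ k)"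
proof (cases "\<exists>i. (i, k) \<in> E \<and> i \<noteq> k")
  case True
  then obtain i where i: "(i, k) \<in> E" "i \<noteq> k" by blast
  \<comment> \<open>By the grading this set is closed under parents and contains all parents of
    \<open>k\<close>; its rows are those assumed to agree.\<close>
  define P where "P = {j. h j < h k}"
  have P: "u \<in> P" if "(u, v) \<in> E" "v \<in> P" for u v
    using that h_less[of u v] by (cases "u = v") (auto simp: P_def)
  have k: "k \<notin> P" and parents: "u \<in> insert k P" if "(u, k) \<in> E" for u
    using that h_less[of u k] by (auto simp: P_def)
  have "i \<in> P" using parents i by blast
  obtain p q where p: "real_polynomial_function p"
    and q: "\<And>\<theta>. \<theta> \<in> parameter_space E \<Longrightarrow> q \<theta> \<noteq> 0"
    and pq: "\<And>\<theta>. \<theta> \<in> parameter_space E \<Longrightarrow> det (cumulant_matrix P i k \<theta>) = p \<theta> / q \<theta>"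
    using rational_onE[OF rational_det_cumulant_matrix[of P i k]] by metis
  let ?\<theta> = "(single_edge_matrix i k, 1, 1, 1)"
  have "?\<theta> \<in> parameter_space E"
    by (rule single_edge_mem_parameter_space[OF loops i(1)])
  moreover from this have "p ?\<theta> \<noteq> 0"
    using det_cumulant_matrix_single_edge[OF i \<open>i \<in> P\<close> k[OF i(1)]] pq by auto
  moreover have "fst \<theta>' $ k = fst \<theta> $ k"
    if "\<theta> \<in> parameter_space E" "\<theta>' \<in> parameter_space E" "p \<theta> \<noteq> 0"
      "cumulants \<theta>' = cumulants \<theta>" "\<forall>j. h j < h k \<longrightarrow> fst \<theta>' $ j = fst \<theta> $ j" for \<theta> \<theta>'
  proof -
    have det: "det (cumulant_matrix P i k \<theta>) \<noteq> 0" using pq q that by simp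
    obtain A w2 w3 w4 A' w2' w3' w4' where \<theta>: "\<theta> = (A, w2, w3, w4)" "\<theta>' = (A', w2', w3', w4')"
      by (metis prod_cases4)
    have "A' $ k = A $ k"
      by (rule row_eq[OF that(1,2,4)[unfolded \<theta>] P k[OF i(1)] parents _ \<open>i \<in> P\<close> det[unfolded \<theta>]])
        (use that(5) in \<open>simp_all add: \<theta> P_def\<close>)
    then show ?thesis by (simp add: \<theta>)
  qed
  ultimately show ?thesis using p by blast
next
  case False
  then have src: "l = k" if "(l, k) \<in> E" for l using that by blast
  have "\<exists>j. (k, j) \<in> E \<and> j \<noteq> k" using assms(2) False by (auto simp: isolated_node_def)
  \<comment> \<open>Proper descendants of \<open>k\<close> are at least as high as a lowest child
    \<open>j\<close>, while the other parents of \<open>j\<close> are lower than \<open>j\<close>;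
    so those other than \<open>k\<close> are not descendants of \<open>k\<close>.\<close>
  then obtain j where j: "(k, j) \<in> E" "j \<noteq> k"
    and min: "\<And>l. (k, l) \<in> E \<Longrightarrow> l \<noteq> k \<Longrightarrow> h j \<le> h l"
    using ex_has_least_nat[of "\<lambda>j. (k, j) \<in> E \<and> j \<noteq> k" _ h] by blast
  have reach: "h j \<le> h l" if "(k, l) \<in> E\<^sup>*" "l \<noteq> k" for l
    using that
  proof (induction rule: rtrancl_induct)
    case base
    then show ?case by simp
  next
    case (step y z)
    show ?case
    proof (cases "y = k \<or> y = z")
      case True
      then show ?thesis using step min by auto
    next
      case False
      then show ?thesis using step h_less[of y z] by auto
    qed
  qed
  have par: "(k, l) \<notin> E\<^sup>*" if "(l, j) \<in> E" "l \<noteq> k" "l \<noteq> j" for l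
    using reach[of l] h_less[of l j] that by auto
  define f :: "'n params \<Rightarrow> real" where "f = (\<lambda>\<theta>. fst \<theta> $ j $ k)"
  have "f (single_edge_matrix k j, 1, 1, 1) \<noteq> 0"
    using j by (simp add: f_def single_edge_matrix_def)
  moreover have "real_polynomial_function f" unfolding f_def by (rule polynomial_fst_nth)
  moreover have "fst \<theta>' $ k = fst \<theta> $ k"
    if "\<theta> \<in> parameter_space E" "\<theta>' \<in> parameter_space E" "f \<theta> \<noteq> 0"
      "cumulants \<theta>' = cumulants \<theta>" for \<theta> \<theta>'
  proof -
    obtain A w2 w3 w4 A' w2' w3' w4' where \<theta>: "\<theta> = (A, w2, w3, w4)" "\<theta>' = (A', w2', w3', w4')"
      by (metis prod_cases4)
    have "A' $ k $ k = A $ k $ k"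
      by (rule source_weight_eq[OF that(1,2,4)[unfolded \<theta>] src j(1) j(2)[symmetric] par])
        (use that(3) in \<open>simp_all add: \<theta> f_def\<close>)
    moreover have "A' $ k $ l = A $ k $ l" if "l \<noteq> k" for l
    proof -
      have "A \<in> edge_matrices E" "A' \<in> edge_matrices E"
        using \<open>\<theta> \<in> _\<close> \<open>\<theta>' \<in> _\<close> by (simp_all add: \<theta> mem_parameter_space_iff)
      moreover have "(l, k) \<notin> E" using src that by blast
      ultimately show ?thesis by (simp add: edge_matrices_def)
    qed
    ultimately show ?thesis unfolding \<theta> by (metis fst_conv vec_eq_iff)
  qed
  ultimately show ?thesis using single_edge_mem_parameter_space[OF loops j(1)] by blast
qed

end

section \<open>Generic identifiability of the whole matrix\<close>

theorem theorem4p3: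
  fixes E :: "('n::finite \<times> 'n) set"
  assumes "CARD('n) \<ge> 2"
    and "\<forall>v. (v, v) \<in> E"
    and "acyclic (E - Id)"
    and "\<forall>v. \<not> isolated_node E v"
  shows "generically_identifiable E"
proof -
  obtain h where "graded_graph E h"
    using acyclic_imp_graded_graph[OF assms(3)] by blast
  then interpret graded_graph E h .
  let ?\<Theta> = "parameter_space E"
  obtain f where f_row: "\<forall>k. real_polynomial_function (f k) \<and> (\<exists>\<theta> \<in> ?\<Theta>. f k \<theta> \<noteq> 0) \<and>
    (\<forall>\<theta> \<in> ?\<Theta>. \<forall>\<theta>' \<in> ?\<Theta>. f k \<theta> \<noteq> 0 \<longrightarrow> cumulants \<theta>' = cumulants \<theta> \<longrightarrow>
      (\<forall>j. h j < h k \<longrightarrow> fst \<theta>' $ j = fst \<theta> $ j) \<longrightarrow> fst \<theta>' $ k = fst \<theta> $ k)"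
    using choice[OF allI[OF generic_row_polynomial[OF assms(2) spec[OF assms(4)]]]] ..
  have f: "real_polynomial_function (f k)" and nz: "\<exists>\<theta> \<in> ?\<Theta>. f k \<theta> \<noteq> 0" for k
    using f_row by auto
  \<comment> \<open>Outside the zero set of this product the conditions of all rows hold at
    once.\<close>
  define F where "F \<theta> = (\<Prod>k\<in>UNIV. f k \<theta>)" for \<theta>
  define Z where "Z = {\<theta> \<in> ?\<Theta>. \<forall>f\<in>{F}. f \<theta> = 0}"
  have "real_polynomial_function F"
    unfolding F_def by (intro real_polynomial_function_prod f) simp
  moreover have "Z \<noteq> ?\<Theta>"
    using parameter_space_prod_nonvanishing[of UNIV f, OF _ _ f nz] by (auto simp: Z_def F_def)
  ultimately have "proper_algebraic_subset ?\<Theta> Z"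
    unfolding proper_algebraic_subset_def Z_def by blast
  moreover have "fst \<theta>' = fst \<theta>"
    if \<theta>: "\<theta> \<in> ?\<Theta> - Z" and \<theta>': "\<theta>' \<in> ?\<Theta>" and eq: "cumulants \<theta>' = cumulants \<theta>" for \<theta> \<theta>'
  proof -
    have nz: "f k \<theta> \<noteq> 0" for k using \<theta> by (simp add: Z_def F_def)
    \<comment> \<open>The rows are recovered in order of height.\<close>
    have "fst \<theta>' $ k = fst \<theta> $ k" for k
    proof (induction k rule: measure_induct_rule[of h])
      case (less k)
      then show ?case using f_row \<theta> \<theta>' eq nz[of k] by blast
    qed
    then show ?thesis by (simp add: vec_eq_iff)
  qed
  ultimately show ?thesis unfolding generically_identifiable_def by blast
qed

end
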